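(* Let $r>0$ and let $f(z)=\prod_{j=1}^d(z-\zeta_j)$ with $\zeta_j\in\mathbb C$ and $|\zeta_j|<r$ for all $j$. Then $$\int_0^1\log|f(re^{2\pi i t})|\,dt=d\log r.$$ *)

theory Defs
  imports "HOL-Analysis.Analysis"
begin

end

theory Submission
  imports Defs "HOL-Complex_Analysis.Cauchy_Integral_Formula"
begin

text \<open>The logarithm turns the product into a sum, so it suffices to treat one factor. For
  \<open>|u| = 1\<close> we have \<open>|r u - a| = |r - cnj a u|\<close>, and \<open>Ln (r - cnj a u)\<close> is holomorphic on
  the closed unit disc because \<open>r - cnj a u\<close> has positive real part there. The mean value
  property at \<open>0\<close> gives the value \<open>ln r\<close>.\<close>

text \<open>Parametrising Cauchy's formula gives this: the derivative of the circle path at the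
  point \<open>u\<close> is \<open>c * (u - w)\<close>, which cancels the kernel
  \<open>1 / (u - w)\<close> and leaves only the constant \<open>c\<close>.\<close>

lemma has_integral_circle_mean:
  fixes g :: "complex \<Rightarrow> complex"
  assumes "R > 0" "continuous_on (cball w R) g" "g holomorphic_on ball w R"
  shows "((\<lambda>t. g (circlepath w R t)) has_integral g w) {0..1}"
proof -
  define c where "c = 2 * of_real pi * \<i>"
  have "c \<noteq> 0"
    by (simp add: c_def)
  have "((\<lambda>u. g u / (u - w)) has_contour_integral c * g w) (circlepath w R)"
    unfolding c_def using assms by (intro Cauchy_integral_circlepath) auto
  then have "((\<lambda>t. c * g (circlepath w R t)) has_integral c * g w) {0..1}"
    unfolding has_contour_integral vector_derivative_circlepath
    by (rule has_integral_eq[rotated]) (use \<open>R > 0\<close> in \<open>simp add: c_def circlepath field_simps\<close>)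
  from has_integral_mult_right[OF this, of "inverse c"]
  show ?thesis
    using \<open>c \<noteq> 0\<close> by (simp add: mult.assoc[symmetric])
qed

text \<open>Conjugation and multiplication by the unit \<open>u\<close> both preserve the modulus.
  For \<open>cmod a < r\<close> the left-hand expression has its zero \<open>a / r\<close> inside
  the unit disc, where no logarithm exists; the right-hand one has no zero in the closed
  disc.\<close>

lemma cmod_of_real_mult_unit_diff:
  assumes "cmod u = 1"
  shows "cmod (of_real r * u - a) = cmod (of_real r - cnj a * u)"
proof -
  have "cnj u * u = 1"
    using assms by (simp add: complex_norm_square[symmetric] mult.commute)
  then have "cnj (of_real r * u - a) * u = of_real r - cnj a * u"
    by (simp add: algebra_simps)
  then have "cmod (cnj (of_real r * u - a)) * cmod u = cmod (of_real r - cnj a * u)"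
    by (metis norm_mult)
  then show ?thesis
    using assms by (simp only: complex_mod_cnj mult_1_right)
qed

lemma has_integral_ln_cmod_circle_diff:
  assumes "cmod a < r"
  shows "((\<lambda>t. ln (cmod (of_real r * exp (2 * of_real pi * \<i> * of_real t) - a)))
    has_integral ln r) {0..1}"
proof -
  have "r > 0"
    using assms norm_ge_zero[of a] by linarith
  have pos: "Re (of_real r - cnj a * u) > 0" if "u \<in> cball 0 1" for u
  proof -
    have "cmod (cnj a * u) \<le> cmod a"
      using that by (simp add: norm_mult mult_left_le)
    then show ?thesis
      using assms complex_Re_le_cmod[of "cnj a * u"] by simp
  qed
  define g where "g u = Ln (of_real r - cnj a * u)" for u
  have "g holomorphic_on cball 0 1"
    unfolding g_def using pos
    by (intro holomorphic_intros) (meson complex_nonpos_Reals_iff not_less)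
  then have "((\<lambda>t. g (circlepath 0 1 t)) has_integral g 0) {0..1}"
    by (intro has_integral_circle_mean)
       (auto intro: holomorphic_on_imp_continuous_on holomorphic_on_subset)
  then have "((\<lambda>t. Re (g (circlepath 0 1 t))) has_integral Re (g 0)) {0..1}"
    using has_integral_linear[OF _ bounded_linear_Re] by (auto simp: o_def)
  moreover have "Re (g 0) = ln r"
    using \<open>r > 0\<close> by (simp add: g_def)
  moreover have "Re (g (circlepath 0 1 t)) =
      ln (cmod (of_real r * exp (2 * of_real pi * \<i> * of_real t) - a))" for t
  proof -
    let ?u = "exp (2 * of_real pi * \<i> * of_real t)"
    have "cmod ?u = 1"
      by simp
    \<comment> \<open>The identity \<open>Re (Ln z) = ln (cmod z)\<close> is applied at this value,
      so it must be nonzero.\<close>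
    moreover have "of_real r - cnj a * ?u \<noteq> 0"
      using pos[of ?u] by force
    ultimately show ?thesis
      by (simp add: g_def circlepath cmod_of_real_mult_unit_diff)
  qed
  ultimately show ?thesis
    by simp
qed

theorem corollary5p10:
  fixes r :: real and d :: nat and \<zeta> :: "nat \<Rightarrow> complex" and f :: "complex \<Rightarrow> complex"
  assumes "r > 0"
    and "\<And>z. f z = (\<Prod>j = 1..d. z - \<zeta> j)"
    and "\<And>j. j \<in> {1..d} \<Longrightarrow> cmod (\<zeta> j) < r"
  shows "((\<lambda>t::real. ln (cmod (f (complex_of_real r * exp (2 * complex_of_real pi * \<i> * complex_of_real t)))))
           has_integral (real d * ln r)) {0..1}"
proof -
  let ?z = "\<lambda>t. of_real r * exp (2 * of_real pi * \<i> * of_real t)"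
  have "((\<lambda>t. \<Sum>j = 1..d. ln (cmod (?z t - \<zeta> j))) has_integral (\<Sum>j = 1..d. ln r)) {0..1}"
    using assms(3) by (intro has_integral_sum has_integral_ln_cmod_circle_diff) auto
  moreover have "ln (cmod (f (?z t))) = (\<Sum>j = 1..d. ln (cmod (?z t - \<zeta> j)))" for t
  proof -
    \<comment> \<open>All roots lie strictly inside the circle of radius \<open>r\<close>, so no
      factor vanishes on it and the logarithm of the product splits for every
      \<open>t\<close>.\<close>
    have "cmod (?z t) = r"
      using \<open>r > 0\<close> by (simp add: norm_mult)
    then have "cmod (?z t - \<zeta> j) > 0" if "j \<in> {1..d}" for j
      using assms(3)[OF that] by auto
    then show ?thesis
      unfolding assms(2) prod_norm[symmetric] by (intro ln_prod) auto
  qed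
  ultimately show ?thesis
    by simp
qed

end
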